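(* For every integer $n\ge 1$, the matrix ring over dual numbers $M_n(\mathbb{D})$ is an $\mathrm{NR}$-clean ring.
   Context: $\mathbb{D}=\{a+b\epsilon \mid a,b\in\mathbb{R},\ \epsilon^2=0\}$ is the ring of dual numbers, and $M_n(\mathbb{D})$ is the ring of $n\times n$ matrices over $\mathbb{D}$. An element $r$ of a ring $R$ (associative with identity) is (von Neumann) regular if $r=rxr$ for some $x\in R$. An element $a\in R$ is $\mathrm{NR}$-clean if $a=r+t$ with $r\in R$ regular and $t\in R$ nilpotent. A ring is $\mathrm{NR}$-clean if every element of it is $\mathrm{NR}$-clean. *)

theory Defs
  imports Complex_Main "Jordan_Normal_Form.Matrix"
begin

text \<open>\<open>Dual a b\<close> represents $a + b\epsilon$ with $\epsilon^2 = 0$.\<close>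

datatype dual_num = Dual (dual_re: real) (dual_eps: real)

instantiation dual_num :: comm_ring_1
begin

definition zero_dual_num :: dual_num where
  "0 = Dual 0 0"

definition one_dual_num :: dual_num where
  "1 = Dual 1 0"

definition plus_dual_num :: "dual_num \<Rightarrow> dual_num \<Rightarrow> dual_num" where
  "x + y = Dual (dual_re x + dual_re y) (dual_eps x + dual_eps y)"

definition uminus_dual_num :: "dual_num \<Rightarrow> dual_num" where
  "- x = Dual (- dual_re x) (- dual_eps x)"

definition minus_dual_num :: "dual_num \<Rightarrow> dual_num \<Rightarrow> dual_num" where
  "x - y = Dual (dual_re x - dual_re y) (dual_eps x - dual_eps y)"

definition times_dual_num :: "dual_num \<Rightarrow> dual_num \<Rightarrow> dual_num" where
  "x * y = Dual (dual_re x * dual_re y) (dual_re x * dual_eps y + dual_eps x * dual_re y)"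

instance
  by standard
    (auto simp: zero_dual_num_def one_dual_num_def plus_dual_num_def uminus_dual_num_def
      minus_dual_num_def times_dual_num_def algebra_simps)

end

lemma dual_eps_square: "Dual 0 1 * Dual 0 1 = 0"
  by (simp add: times_dual_num_def zero_dual_num_def)

lemma dual_num_decomp: "Dual a b = Dual a 0 + Dual b 0 * Dual 0 1"
  by (simp add: times_dual_num_def plus_dual_num_def)

definition regular_element :: "('a, 'b) ring_scheme \<Rightarrow> 'a \<Rightarrow> bool" where
  "regular_element R r \<longleftrightarrow>
     r \<in> carrier R \<and> (\<exists>x\<in>carrier R. r = r \<otimes>\<^bsub>R\<^esub> x \<otimes>\<^bsub>R\<^esub> r)"

definition nilpotent_element :: "('a, 'b) ring_scheme \<Rightarrow> 'a \<Rightarrow> bool" where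
  "nilpotent_element R t \<longleftrightarrow>
     t \<in> carrier R \<and> (\<exists>k::nat. k \<ge> 1 \<and> t [^]\<^bsub>R\<^esub> k = \<zero>\<^bsub>R\<^esub>)"

definition NR_clean_element :: "('a, 'b) ring_scheme \<Rightarrow> 'a \<Rightarrow> bool" where
  "NR_clean_element R a \<longleftrightarrow>
     (\<exists>r t. regular_element R r \<and> nilpotent_element R t \<and> a = r \<oplus>\<^bsub>R\<^esub> t)"

definition NR_clean_ring :: "('a, 'b) ring_scheme \<Rightarrow> bool" where
  "NR_clean_ring R \<longleftrightarrow> ring R \<and> (\<forall>a\<in>carrier R. NR_clean_element R a)"

end

theory Submission
  imports Defs
begin

text \<open>Split a dual matrix as \<open>A + B\<epsilon>\<close> with \<open>A\<close> and \<open>B\<close> real: \<open>B\<epsilon>\<close> squares to zero, and \<open>A\<close> is regular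
  because matrix rings over a field are regular. The latter follows from McCoy's lemma (if
  \<open>a - a y a\<close> is regular then so is \<open>a\<close>): taking for \<open>y\<close> the matrix whose only nonzero entry is the
  inverse of a nonzero entry \<open>A\<^sub>i\<^sub>j\<close>, placed at \<open>(j, i)\<close>, the difference \<open>A - A y A\<close> has strictly
  fewer nonzero rows than \<open>A\<close>.\<close>

lemma (in ring) regular_element_McCoy:
  assumes a: "a \<in> carrier R" and y: "y \<in> carrier R"
    and reg: "regular_element R (a \<ominus> a \<otimes> y \<otimes> a)"
  shows "regular_element R a"
proof -
  obtain x where x: "x \<in> carrier R"
    and eq: "a \<ominus> a \<otimes> y \<otimes> a = (a \<ominus> a \<otimes> y \<otimes> a) \<otimes> x \<otimes> (a \<ominus> a \<otimes> y \<otimes> a)"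
    using reg unfolding regular_element_def by blast
  \<comment> \<open>The element \<open>a - a y a\<close> factors both as \<open>a (1 - y a)\<close>
    and as \<open>(1 - a y) a\<close>. Using the first factorisation on the left of \<open>x\<close>
    and the second on the right puts \<open>a\<close> at both outer ends, so
    \<open>a = a z a\<close> with \<open>z = y + (1 - y a) x (1 - a y)\<close>.\<close>
  let ?l = "\<one> \<ominus> y \<otimes> a" and ?r = "\<one> \<ominus> a \<otimes> y"
  have l: "a \<otimes> ?l = a \<ominus> a \<otimes> y \<otimes> a" and r: "?r \<otimes> a = a \<ominus> a \<otimes> y \<otimes> a"
    using a y by (simp_all add: minus_eq l_distr r_distr l_minus r_minus m_assoc)
  have "a = a \<otimes> y \<otimes> a \<oplus> (a \<ominus> a \<otimes> y \<otimes> a)"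
    using a y by (simp add: minus_eq a_lcomm[of "a \<otimes> y \<otimes> a"] r_neg)
  also have "\<dots> = a \<otimes> y \<otimes> a \<oplus> (a \<otimes> ?l) \<otimes> x \<otimes> (?r \<otimes> a)"
    using eq by (simp only: l r)
  also have "\<dots> = a \<otimes> (y \<oplus> ?l \<otimes> x \<otimes> ?r) \<otimes> a"
    using a x y by (simp add: l_distr r_distr m_assoc)
  finally show ?thesis
    unfolding regular_element_def using a x y
    by (intro conjI bexI[of _ "y \<oplus> ?l \<otimes> x \<otimes> ?r"]) auto
qed

lemma index_mult_mat_sum:
  assumes "A \<in> carrier_mat m n" "B \<in> carrier_mat n p" "i < m" "j < p"
  shows "(A * B) $$ (i, j) = (\<Sum>k\<in>{0..<n}. A $$ (i, k) * B $$ (k, j))"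
  using assms by (simp add: scalar_prod_def)

text \<open>The single entry of the middle factor picks out column \<open>j\<close> of the left
  \<open>A\<close> and row \<open>i\<close> of the right \<open>A\<close>, so the product is
  \<open>c\<close> times the outer product of that column and that row.\<close>

lemma index_mult_single_entry_mult:
  fixes A :: "'a :: comm_ring_1 mat"
  assumes A: "A \<in> carrier_mat n n" and ij: "i < n" "j < n" and kl: "k < n" "l < n"
  shows "(A * mat n n (\<lambda>(p, q). if p = j \<and> q = i then c else 0) * A) $$ (k, l)
    = A $$ (k, j) * c * A $$ (i, l)"
proof -
  let ?Y = "mat n n (\<lambda>(p, q). if p = j \<and> q = i then c else 0)"
  have AY: "(A * ?Y) $$ (k, q) = (if q = i then A $$ (k, j) * c else 0)" if "q < n" for q
  proof -
    have "(A * ?Y) $$ (k, q) = (\<Sum>p\<in>{0..<n}. A $$ (k, p) * (if p = j \<and> q = i then c else 0))"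
      using A kl that by (simp add: scalar_prod_def)
    also have "\<dots> = (\<Sum>p\<in>{0..<n}. if p = j then (if q = i then A $$ (k, j) * c else 0) else 0)"
      by (rule sum.cong) auto
    finally show ?thesis using ij by simp
  qed
  have "(A * ?Y * A) $$ (k, l) = (\<Sum>q\<in>{0..<n}. (A * ?Y) $$ (k, q) * A $$ (q, l))"
    using A kl by (intro index_mult_mat_sum[of _ n _ _ n]) auto
  also have "\<dots> = (\<Sum>q\<in>{0..<n}. if q = i then A $$ (k, j) * c * A $$ (i, l) else 0)"
    by (rule sum.cong) (auto simp: AY simp del: index_mult_mat(1))
  finally show ?thesis using ij by simp
qed

text \<open>McCoy's lemma subtracts by adding the additive inverse of the abstract ring; this
  identifies it with entrywise subtraction, so that the lemma applies to concrete matrices.\<close>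

lemma minus_ring_mat:
  fixes A B :: "'a :: comm_ring_1 mat"
  assumes A: "A \<in> carrier_mat n n" and B: "B \<in> carrier_mat n n"
  shows "A \<ominus>\<^bsub>ring_mat TYPE('a) n ()\<^esub> B = A - B"
proof -
  interpret ring "ring_mat TYPE('a) n ()" by (rule ring_mat)
  have "\<ominus>\<^bsub>ring_mat TYPE('a) n ()\<^esub> B = - B"
    using B by (intro minus_equality) (auto simp: ring_mat_simps)
  then show ?thesis
    using A B by (auto simp: minus_eq ring_mat_simps)
qed

lemma regular_element_ring_mat_field:
  fixes A :: "'a :: field mat"
  assumes "A \<in> carrier_mat n n"
  shows "regular_element (ring_mat TYPE('a) n ()) A"
proof -
  interpret ring "ring_mat TYPE('a) n ()" by (rule ring_mat)
  let ?rows = "\<lambda>A :: 'a mat. {k. k < n \<and> (\<exists>l<n. A $$ (k, l) \<noteq> 0)}"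
  show ?thesis
    using assms
  proof (induction "card (?rows A)" arbitrary: A rule: less_induct)
    case less
    note A = less.prems
    show ?case
    proof (cases "\<exists>i<n. \<exists>j<n. A $$ (i, j) \<noteq> 0")
      case False
      then have "A = 0\<^sub>m n n"
        using A by auto
      then show ?thesis
        using A by (auto simp: regular_element_def ring_mat_simps)
    next
      case True
      then obtain i j where ij: "i < n" "j < n" "A $$ (i, j) \<noteq> 0"
        by blast
      define Y where "Y = mat n n (\<lambda>(p, q). if p = j \<and> q = i then inverse (A $$ (i, j)) else 0)"
      let ?B = "A - A * Y * A"
      have Y: "Y \<in> carrier_mat n n" and B: "?B \<in> carrier_mat n n"
        using A by (auto simp: Y_def)
      \<comment> \<open>This is Gaussian elimination with pivot \<open>(i, j)\<close>: row
        \<open>k\<close> loses \<open>A $$ (k, j) / A $$ (i, j)\<close> times row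
        \<open>i\<close>.\<close>
      have entry: "?B $$ (k, l) = A $$ (k, l) - A $$ (k, j) * inverse (A $$ (i, j)) * A $$ (i, l)"
        if "k < n" "l < n" for k l
        using index_mult_single_entry_mult[OF A ij(1,2) that] A Y that
        by (simp add: Y_def del: index_mult_mat(1))
      have "?rows ?B \<subset> ?rows A"
      proof (rule psubsetI)
        show "?rows ?B \<subseteq> ?rows A"
          \<comment> \<open>If row \<open>k\<close> of \<open>A\<close> vanishes, then so does
            \<open>A $$ (k, j)\<close>, and nothing is subtracted from that row.\<close>
          using ij by (auto simp: entry simp del: index_minus_mat(1)) (metis mult_zero_left)
        \<comment> \<open>For \<open>k = i\<close> the multiplier is 1, so the pivot row cancels
          itself.\<close>
        have "i \<notin> ?rows ?B"
          using ij by (auto simp: entry simp del: index_minus_mat(1))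
        then show "?rows ?B \<noteq> ?rows A"
          using ij by blast
      qed
      then have "card (?rows ?B) < card (?rows A)"
        by (intro psubset_card_mono) auto
      then have "regular_element (ring_mat TYPE('a) n ()) ?B"
        using less.hyps B by blast
      then show ?thesis
        using A Y by (intro regular_element_McCoy[of A Y]) (auto simp: ring_mat_simps minus_ring_mat)
    qed
  qed
qed

text \<open>Applying a homomorphism entrywise respects matrix products, so it carries a witness
  \<open>X\<close> of \<open>A = A X A\<close> to a witness for the image. This transfers regularity
  from real to dual matrices.\<close>

lemma (in semiring_hom) regular_element_ring_mat_hom:
  assumes "regular_element (ring_mat TYPE('a) n b) A"
  shows "regular_element (ring_mat TYPE('b) n c) (map_mat hom A)"
proof -
  obtain X where A: "A \<in> carrier_mat n n" and X: "X \<in> carrier_mat n n" and eq: "A = A * X * A"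
    using assms by (auto simp: regular_element_def ring_mat_simps)
  have "map_mat hom A = map_mat hom A * map_mat hom X * map_mat hom A"
    using arg_cong[OF eq, of "map_mat hom"] A X
    by (simp add: mat_hom_mult[of _ n n _ n])
  then show ?thesis
    using A X by (auto simp: regular_element_def ring_mat_simps)
qed

lemma semiring_hom_Dual: "semiring_hom (\<lambda>x. Dual x 0)"
  by standard
    (auto simp: zero_dual_num_def one_dual_num_def plus_dual_num_def times_dual_num_def)

text \<open>Every entry is a real multiple of the dual unit, whose square is 0; hence each summand
  of each entry of \<open>T * T\<close> vanishes and the exponent 2 suffices.\<close>

lemma nilpotent_element_ring_mat_dual:
  fixes T :: "dual_num mat"
  assumes T: "T \<in> carrier_mat n n" and re: "\<And>i j. i < n \<Longrightarrow> j < n \<Longrightarrow> dual_re (T $$ (i, j)) = 0"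
  shows "nilpotent_element (ring_mat TYPE(dual_num) n ()) T"
proof -
  interpret ring "ring_mat TYPE(dual_num) n ()" by (rule ring_mat)
  have "T * T = 0\<^sub>m n n"
  proof (rule eq_matI)
    fix i j assume ij: "i < dim_row (0\<^sub>m n n)" "j < dim_col (0\<^sub>m n n)"
    then have "(T * T) $$ (i, j) = (\<Sum>k\<in>{0..<n}. T $$ (i, k) * T $$ (k, j))"
      by (intro index_mult_mat_sum[OF T T]) auto
    also have "\<dots> = 0"
      using ij by (intro sum.neutral ballI) (simp add: re times_dual_num_def zero_dual_num_def)
    finally show "(T * T) $$ (i, j) = 0\<^sub>m n n $$ (i, j)"
      using ij by simp
  qed (use T in auto)
  then have "T [^]\<^bsub>ring_mat TYPE(dual_num) n ()\<^esub> (2::nat) = \<zero>\<^bsub>ring_mat TYPE(dual_num) n ()\<^esub>"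
    using T by (simp add: numeral_2_eq_2 ring_mat_simps)
  then show ?thesis
    using T by (auto simp: nilpotent_element_def ring_mat_simps intro!: exI[of _ "2::nat"])
qed

theorem theorem4p10:
  fixes n :: nat
  assumes "n \<ge> 1"
  shows "NR_clean_ring (ring_mat TYPE(dual_num) n ())"
  unfolding NR_clean_ring_def NR_clean_element_def
proof (intro conjI ballI)
  let ?R = "ring_mat TYPE(dual_num) n ()"
  show "ring ?R" by (rule ring_mat)
  fix M assume "M \<in> carrier ?R"
  then have M: "M \<in> carrier_mat n n" by (simp add: ring_mat_simps)
  \<comment> \<open>The inner map lands in matrices over the field of reals, where every matrix is
    regular; the outer one embeds them back into the dual matrices.\<close>
  let ?A = "map_mat (\<lambda>x. Dual x 0) (map_mat dual_re M)"
  let ?T = "map_mat (\<lambda>x. Dual 0 (dual_eps x)) M"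
  have "regular_element ?R ?A"
    using M by (intro semiring_hom.regular_element_ring_mat_hom[OF semiring_hom_Dual, where b = "()"]
      regular_element_ring_mat_field) simp
  moreover have "nilpotent_element ?R ?T"
    using M by (intro nilpotent_element_ring_mat_dual) auto
  moreover have "M = ?A \<oplus>\<^bsub>?R\<^esub> ?T"
    using M by (auto simp: ring_mat_simps plus_dual_num_def intro!: eq_matI)
  ultimately show "\<exists>r t. regular_element ?R r \<and> nilpotent_element ?R t \<and> M = r \<oplus>\<^bsub>?R\<^esub> t"
    by blast
qed

end
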